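(* Let $H$ be a real Hilbert space and let $F=f+g$, where $f:H\to\mathbb{R}$ is $\mu$-strongly convex and $L$-smooth with $L\ge\mu>0$, and $g:H\to\mathbb{R}\cup\{\infty\}$ is convex, proper and lower-semicontinuous. Assume $\operatorname{argmin}(F)\neq\emptyset$, let $x^*\in\operatorname{argmin}(F)$ and $F^*=F(x^* )$. Let $$s\in\left(0,\frac1L\right]\quad\text{and}\quad\gamma\in\left(\frac{1-sL}{4},\,2-sL\right),$$ and let $(x_k),(y_k),(z_k)$ be generated by (M-APM) from initial points $x_0,y_0\in H$. Then for every $k\ge2$, $$F(y_k)-F^*\le\frac{\|x_0-x^*\|^2}{2\gamma s t_k(t_k-1)}(1+\rho)^{-k+2},\quad\text{where}\quad \rho=\min\left\{\frac{\mu s(2-\gamma-sL)}{1-\mu s(2-4\gamma-sL)},\ \frac{\mu\gamma s}{2}\right\}.$$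
   Context: $L$-smooth means $f$ is differentiable with $L$-Lipschitz gradient. $\mu$-strongly convex means $f-\frac{\mu}{2}\|\cdot\|^2$ is convex. $\operatorname{prox}_{sg}(v)=\operatorname{arg\,min}_{u\in H}\{g(u)+\frac{1}{2s}\|u-v\|^2\}$. The sequence $(t_k)_{k\ge0}$ is $t_0=1$, $t_k=\frac{1+\sqrt{1+4t_{k-1}^2}}{2}$ for $k\ge1$. Algorithm (M-APM): given $x_0,y_0\in H$, for $k\ge0$, $$z_k=\operatorname{prox}_{sg}(x_k-s\nabla f(x_k)),\qquad y_{k+1}=\begin{cases}z_k,&\text{if }F(z_k)\le F(y_k),\\ y_k,&\text{otherwise},\end{cases}$$ $$x_{k+1}=y_{k+1}+\frac{t_k-1}{t_{k+1}}(y_{k+1}-y_k)+\frac{t_k}{t_{k+1}}(z_k-y_{k+1})+\frac{t_k(\gamma-1)}{t_{k+1}}(z_k-x_k).$$ *)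

theory Defs
  imports "HOL-Analysis.Analysis"
begin

definition grad :: "('a::real_inner \<Rightarrow> real) \<Rightarrow> 'a \<Rightarrow> 'a" where
  "grad f x = (THE D. GDERIV f x :> D)"

(* On a Hilbert space, Frechet differentiability at x and existence of the gradient at x
   coincide, by the Riesz representation theorem. *)
definition L_smooth :: "real \<Rightarrow> ('a::real_inner \<Rightarrow> real) \<Rightarrow> bool" where
  "L_smooth L f \<longleftrightarrow> (\<forall>x. \<exists>D. GDERIV f x :> D) \<and> L-lipschitz_on UNIV (grad f)"

definition strongly_convex :: "real \<Rightarrow> ('a::real_inner \<Rightarrow> real) \<Rightarrow> bool" where
  "strongly_convex \<mu> f \<longleftrightarrow> convex_on UNIV (\<lambda>x. f x - \<mu> / 2 * (norm x)\<^sup>2)"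

(* Functions into the reals extended by +infinity are modelled with values in ereal;
   properness also excludes the value -infinity. *)
definition proper_fun :: "('a \<Rightarrow> ereal) \<Rightarrow> bool" where
  "proper_fun g \<longleftrightarrow> (\<forall>x. g x \<noteq> -\<infinity>) \<and> (\<exists>x. g x \<noteq> \<infinity>)"

definition ereal_convex :: "('a::real_vector \<Rightarrow> ereal) \<Rightarrow> bool" where
  "ereal_convex g \<longleftrightarrow> (\<forall>x y. \<forall>u\<ge>0. \<forall>v\<ge>0. u + v = 1 \<longrightarrow>
     g (u *\<^sub>R x + v *\<^sub>R y) \<le> ereal u * g x + ereal v * g y)"

definition lower_semicontinuous :: "('a::topological_space \<Rightarrow> ereal) \<Rightarrow> bool" where
  "lower_semicontinuous g \<longleftrightarrow> (\<forall>x. g x \<le> Liminf (at x) g)"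

(* For s > 0 and g proper, convex and lower semicontinuous on a Hilbert space the minimizer
   exists and is unique, so the choice made by ARG_MIN is immaterial. *)
definition prox :: "real \<Rightarrow> ('a::real_inner \<Rightarrow> ereal) \<Rightarrow> 'a \<Rightarrow> 'a" where
  "prox s g v = (ARG_MIN (\<lambda>u. g u + ereal (1 / (2 * s) * (norm (u - v))\<^sup>2)) u. True)"

definition composite :: "('a \<Rightarrow> real) \<Rightarrow> ('a \<Rightarrow> ereal) \<Rightarrow> 'a \<Rightarrow> ereal" where
  "composite f g x = ereal (f x) + g x"

fun tseq :: "nat \<Rightarrow> real" where
  "tseq 0 = 1"
| "tseq (Suc k) = (1 + sqrt (1 + 4 * (tseq k)\<^sup>2)) / 2"

definition M_APM ::
  "('a::real_inner \<Rightarrow> real) \<Rightarrow> ('a \<Rightarrow> ereal) \<Rightarrow> real \<Rightarrow> real \<Rightarrow>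
   (nat \<Rightarrow> 'a) \<Rightarrow> (nat \<Rightarrow> 'a) \<Rightarrow> (nat \<Rightarrow> 'a) \<Rightarrow> bool" where
  "M_APM f g s \<gamma> x y z \<longleftrightarrow> (\<forall>k.
     z k = prox s g (x k - s *\<^sub>R grad f (x k)) \<and>
     y (Suc k) = (if composite f g (z k) \<le> composite f g (y k) then z k else y k) \<and>
     x (Suc k) = y (Suc k)
       + ((tseq k - 1) / tseq (Suc k)) *\<^sub>R (y (Suc k) - y k)
       + (tseq k / tseq (Suc k)) *\<^sub>R (z k - y (Suc k))
       + (tseq k * (\<gamma> - 1) / tseq (Suc k)) *\<^sub>R (z k - x k))"

end

theory Submission
  imports Defs
begin

text \<open>
  Put \<open>G\<^sub>k = (x\<^sub>k - z\<^sub>k) / s\<close> and \<open>w\<^sub>k = t\<^sub>k x\<^sub>k - (t\<^sub>k - 1) y\<^sub>k\<close>. The update of \<open>x\<close> says exactly that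
  \<open>w\<^sub>k\<^sub>+\<^sub>1 = w\<^sub>k - \<gamma> s t\<^sub>k G\<^sub>k\<close>. The Lyapunov function
  \<open>E\<^sub>k = t\<^sub>k (t\<^sub>k - 1) (F y\<^sub>k - F x\<^sup>*) + |w\<^sub>k - x\<^sup>*|\<^sup>2 / (2 \<gamma> s)\<close> decreases in each step by at least
  \<open>t\<^sub>k\<^sup>2 (s / 2) (2 - \<gamma> - s L) |G\<^sub>k|\<^sup>2 + (\<mu> / 2) (t\<^sub>k (t\<^sub>k - 1) |x\<^sub>k - y\<^sub>k|\<^sup>2 + t\<^sub>k |x\<^sub>k - x\<^sup>*|\<^sup>2)\<close>,
  by the prox-gradient inequality at \<open>y\<^sub>k\<close> and at \<open>x\<^sup>*\<close>. Both parts of \<open>E\<^sub>k\<^sub>+\<^sub>1\<close> are bounded by these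
  same quantities, which gives \<open>(1 + \<rho>) E\<^sub>k\<^sub>+\<^sub>1 \<le> E\<^sub>k\<close> for all \<open>k\<close>, starting from
  \<open>E\<^sub>0 = |x\<^sub>0 - x\<^sup>*|\<^sup>2 / (2 \<gamma> s)\<close>. The value \<open>F y\<^sub>0\<close> may be infinite, but its coefficient vanishes
  because \<open>t\<^sub>0 = 1\<close>.
\<close>

section \<open>Quadratic lower and upper bounds for the smooth part\<close>

text \<open>Along the line through \<open>x\<close> and \<open>y\<close>, the function left after
  subtracting the quadratic is convex in one real variable, so it lies above its tangent at 0. At
  parameter 1 the quadratic terms recombine into
  \<open>\<mu> / 2 * (norm (y - x))\<^sup>2\<close>.\<close>

lemma strongly_convex_tangent:
  fixes f :: "'a::real_inner \<Rightarrow> real"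
  assumes "strongly_convex \<mu> f" and D: "GDERIV f x :> D"
  shows "f y \<ge> f x + D \<bullet> (y - x) + \<mu> / 2 * (norm (y - x))\<^sup>2"
proof -
  define h where "h = (\<lambda>r::real. f (x + r *\<^sub>R (y - x)) - \<mu> / 2 * (norm (x + r *\<^sub>R (y - x)))\<^sup>2)"
  have cvx: "convex_on UNIV (\<lambda>x. f x - \<mu> / 2 * (norm x)\<^sup>2)"
    using assms by (simp add: strongly_convex_def)
  have hcvx: "convex_on UNIV h"
  proof (rule convex_onI)
    fix t a b :: real assume t: "0 < t" "t < 1"
    have "x + ((1 - t) *\<^sub>R a + t *\<^sub>R b) *\<^sub>R (y - x)
      = (1 - t) *\<^sub>R (x + a *\<^sub>R (y - x)) + t *\<^sub>R (x + b *\<^sub>R (y - x))"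
      by (simp add: algebra_simps)
    then show "h ((1 - t) *\<^sub>R a + t *\<^sub>R b) \<le> (1 - t) * h a + t * h b"
      unfolding h_def using convex_onD[OF cvx, of t] t by simp
  qed auto
  have "(f has_derivative (\<lambda>d. d \<bullet> D)) (at x)"
    using D by (simp add: gderiv_def)
  then have "(f has_derivative (\<lambda>d. d \<bullet> D)) (at (x + 0 *\<^sub>R (y - x)))" by simp
  moreover have "((\<lambda>r::real. x + r *\<^sub>R (y - x)) has_derivative (\<lambda>r. r *\<^sub>R (y - x))) (at 0)"
    by (auto intro!: derivative_eq_intros)
  ultimately have f': "((\<lambda>r. f (x + r *\<^sub>R (y - x))) has_derivative (\<lambda>r. (r *\<^sub>R (y - x)) \<bullet> D)) (at 0)"
    using has_derivative_compose by blast
  have "(h has_real_derivative ((y - x) \<bullet> D - \<mu> * (x \<bullet> (y - x)))) (at 0)"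
    unfolding h_def power2_norm_eq_inner has_field_derivative_def
    by (rule derivative_eq_intros f' refl | simp add: algebra_simps inner_commute fun_eq_iff)+
  then have "h 1 - h 0 \<ge> ((y - x) \<bullet> D - \<mu> * (x \<bullet> (y - x))) * (1 - 0)"
    by (intro convex_on_imp_above_tangent[OF hcvx]) auto
  then have "h 1 - h 0 \<ge> (y - x) \<bullet> D - \<mu> * (x \<bullet> (y - x))" by simp
  moreover have "\<mu> / 2 * (norm (y - x))\<^sup>2
      = \<mu> / 2 * (norm y)\<^sup>2 - \<mu> / 2 * (norm x)\<^sup>2 - \<mu> * (x \<bullet> (y - x))"
    by (simp add: power2_norm_eq_inner inner_diff_left inner_diff_right inner_commute field_simps)
  moreover have "h 1 = f y - \<mu> / 2 * (norm y)\<^sup>2" "h 0 = f x - \<mu> / 2 * (norm x)\<^sup>2"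
    by (simp_all add: h_def)
  ultimately show ?thesis
    using inner_commute[of D "y - x"] by linarith
qed

text \<open>Along the segment, \<open>f\<close> minus its claimed upper model is nonincreasing: by
  Cauchy-Schwarz and the Lipschitz bound, the change of slope up to parameter \<open>r\<close> is at
  most \<open>L * r * (norm d)\<^sup>2\<close>.\<close>

lemma lipschitz_gradient_descent:
  fixes f :: "'a::real_inner \<Rightarrow> real"
  assumes D: "\<And>x. GDERIV f x :> D x" and lip: "L-lipschitz_on UNIV D"
  shows "f y \<le> f x + D x \<bullet> (y - x) + L / 2 * (norm (y - x))\<^sup>2"
proof -
  define d where "d = y - x"
  define h where "h = (\<lambda>r::real. f (x + r *\<^sub>R d) - r * (D x \<bullet> d) - L / 2 * r\<^sup>2 * (norm d)\<^sup>2)"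
  have deriv: "(h has_real_derivative (d \<bullet> D (x + r *\<^sub>R d) - D x \<bullet> d - L * r * (norm d)\<^sup>2)) (at r)" for r
  proof -
    have "(f has_derivative (\<lambda>u. u \<bullet> D (x + r *\<^sub>R d))) (at (x + r *\<^sub>R d))"
      using D[of "x + r *\<^sub>R d"] by (simp add: gderiv_def)
    moreover have "((\<lambda>r::real. x + r *\<^sub>R d) has_derivative (\<lambda>r. r *\<^sub>R d)) (at r)"
      by (auto intro!: derivative_eq_intros)
    ultimately have "((\<lambda>r. f (x + r *\<^sub>R d)) has_derivative (\<lambda>u. (u *\<^sub>R d) \<bullet> D (x + r *\<^sub>R d))) (at r)"
      using has_derivative_compose by blast
    then have f': "((\<lambda>r. f (x + r *\<^sub>R d)) has_real_derivative (d \<bullet> D (x + r *\<^sub>R d))) (at r)"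
      by (simp add: has_field_derivative_def mult_commute_abs)
    show ?thesis unfolding h_def
      by (rule derivative_eq_intros f' refl | simp add: algebra_simps)+
  qed
  have "h 1 \<le> h 0"
  proof (rule DERIV_nonpos_imp_nonincreasing[of 0 1 h])
    fix r :: real assume r: "0 \<le> r" "r \<le> 1"
    have "d \<bullet> D (x + r *\<^sub>R d) - D x \<bullet> d = d \<bullet> (D (x + r *\<^sub>R d) - D x)"
      by (simp add: inner_diff_right inner_commute)
    also have "\<dots> \<le> norm d * norm (D (x + r *\<^sub>R d) - D x)"
      by (rule norm_cauchy_schwarz)
    also have "\<dots> \<le> norm d * (L * norm (r *\<^sub>R d))"
      using lipschitz_onD[OF lip, of "x + r *\<^sub>R d" x]
      by (intro mult_left_mono) (auto simp: dist_norm)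
    also have "\<dots> = L * r * (norm d)\<^sup>2"
      using r by (simp add: power2_eq_square)
    finally show "\<exists>y. DERIV h r :> y \<and> y \<le> 0"
      using deriv[of r] by (intro exI[of _ "d \<bullet> D (x + r *\<^sub>R d) - D x \<bullet> d - L * r * (norm d)\<^sup>2"]) auto
  qed simp
  then show ?thesis
    by (simp add: h_def d_def)
qed

lemma grad_eqI:
  assumes "GDERIV f x :> D"
  shows "grad f x = D"
  unfolding grad_def
proof (rule the_equality)
  fix D' assume "GDERIV f x :> D'"
  then have "(\<lambda>d. d \<bullet> D') = (\<lambda>d. d \<bullet> D)"
    using assms unfolding gderiv_def by (rule has_derivative_unique)
  then have "(D' - D) \<bullet> (D' - D) = 0"
    by (simp add: inner_diff_right fun_eq_iff)
  then show "D' = D" by simp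
qed (fact assms)

lemma L_smooth_GDERIV:
  assumes "L_smooth L f"
  shows "GDERIV f x :> grad f x"
proof -
  obtain D where "GDERIV f x :> D" using assms by (auto simp: L_smooth_def)
  then show ?thesis using grad_eqI by metis
qed

section \<open>Extended-valued convex functions\<close>

text \<open>The Liminf ignores the point \<open>x\<close> itself. Adding it gives a statement about
  \<open>nhds x\<close>, which composes with any sequence converging to \<open>x\<close>.\<close>

lemma lower_semicontinuous_eventually:
  assumes "lower_semicontinuous g" and "c < g x"
  shows "eventually (\<lambda>u. c < g u) (nhds x)"
proof -
  have "c < Liminf (at x) g"
    using assms unfolding lower_semicontinuous_def by (meson less_le_trans)
  then have "eventually (\<lambda>u. c < g u) (at x)"
    by (rule less_LiminfD)
  then show ?thesis
    using assms(2) by (simp add: eventually_nhds_conv_at)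
qed

lemma ereal_convex_real:
  assumes "ereal_convex g" "proper_fun g" "g a \<noteq> \<infinity>" "g b \<noteq> \<infinity>" "0 \<le> t" "t \<le> 1"
  shows "g ((1 - t) *\<^sub>R a + t *\<^sub>R b) \<noteq> \<infinity>"
    and "real_of_ereal (g ((1 - t) *\<^sub>R a + t *\<^sub>R b))
      \<le> (1 - t) * real_of_ereal (g a) + t * real_of_ereal (g b)"
proof -
  have ninf: "g u \<noteq> -\<infinity>" for u using assms(2) by (simp add: proper_fun_def)
  obtain p q where pq: "g a = ereal p" "g b = ereal q"
    using ninf assms(3,4) by (metis ereal_cases)
  have *: "g ((1 - t) *\<^sub>R a + t *\<^sub>R b) \<le> ereal ((1 - t) * p + t * q)"
    using assms(1)[unfolded ereal_convex_def, rule_format, of "1 - t" t a b] assms(5,6)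
    by (simp add: pq)
  then show "g ((1 - t) *\<^sub>R a + t *\<^sub>R b) \<noteq> \<infinity>" by auto
  with * ninf[of "(1 - t) *\<^sub>R a + t *\<^sub>R b"]
  show "real_of_ereal (g ((1 - t) *\<^sub>R a + t *\<^sub>R b))
      \<le> (1 - t) * real_of_ereal (g a) + t * real_of_ereal (g b)"
    by (cases "g ((1 - t) *\<^sub>R a + t *\<^sub>R b)") (auto simp: pq)
qed

text \<open>An elementary stand-in for an affine minorant, used to make the proximal objective
  bounded below. Semicontinuity gives a bound on a small ball around \<open>a\<close>; convexity
  carries it outward with a loss linear in the distance.\<close>

lemma ereal_convex_linear_lower_bound:
  fixes g :: "'a::real_inner \<Rightarrow> ereal"
  assumes "ereal_convex g" "proper_fun g" "lower_semicontinuous g" and a: "g a \<noteq> \<infinity>"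
  obtains c where "c \<ge> 0"
    and "\<And>u. g u \<noteq> \<infinity> \<Longrightarrow> real_of_ereal (g u) \<ge> real_of_ereal (g a) - 1 - c * norm (u - a)"
proof -
  have ninf: "g u \<noteq> -\<infinity>" for u using assms(2) by (simp add: proper_fun_def)
  obtain p where p: "g a = ereal p" using ninf a by (metis ereal_cases)
  have "eventually (\<lambda>u. ereal (p - 1) < g u) (nhds a)"
    by (rule lower_semicontinuous_eventually) (use assms p in auto)
  then obtain d where d: "d > 0" "\<And>u. dist u a < d \<Longrightarrow> ereal (p - 1) < g u"
    unfolding eventually_nhds_metric by blast
  define r where "r = d / 2"
  have r: "r > 0" "\<And>u. norm (u - a) \<le> r \<Longrightarrow> ereal (p - 1) < g u"
    using d by (auto simp: r_def dist_norm)
  show thesis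
  proof (rule that[of "1 / r"])
    show "1 / r \<ge> 0" using r by simp
    fix u assume u: "g u \<noteq> \<infinity>"
    then obtain q where q: "g u = ereal q" using ninf by (metis ereal_cases)
    show "real_of_ereal (g u) \<ge> real_of_ereal (g a) - 1 - 1 / r * norm (u - a)"
    proof (cases "norm (u - a) \<le> r")
      case True
      then have "ereal (p - 1) < ereal q" using r(2) q by metis
      moreover have "1 / r * norm (u - a) \<ge> 0" using r by simp
      ultimately show ?thesis unfolding p q real_of_ereal.simps less_ereal.simps by linarith
    next
      case False
      then have pos: "norm (u - a) > 0" using r by linarith
      \<comment> \<open>This fraction puts \<open>w\<close> at distance exactly \<open>r\<close>
        from \<open>a\<close>, where the ball bound still holds.\<close>
      define t where "t = r / norm (u - a)"
      have t: "0 < t" "t \<le> 1" using False r pos by (auto simp: t_def divide_simps)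
      define w where "w = (1 - t) *\<^sub>R a + t *\<^sub>R u"
      have "w - a = t *\<^sub>R (u - a)" by (simp add: w_def algebra_simps)
      then have "norm (w - a) = r" using pos r by (simp add: t_def)
      then have "ereal (p - 1) < g w" using r(2)[of w] by simp
      moreover have "g w \<noteq> \<infinity>" "real_of_ereal (g w) \<le> (1 - t) * p + t * q"
        unfolding w_def using ereal_convex_real[OF assms(1,2) a u, of t] t p q by auto
      ultimately have "p - 1 < (1 - t) * p + t * q"
        by (cases "g w") auto
      then have "t * (p - q) < 1" by (simp add: algebra_simps)
      then have "p - q < 1 / t" using t by (simp add: field_simps)
      also have "1 / t = 1 / r * norm (u - a)" by (simp add: t_def)
      finally show ?thesis unfolding p q by simp
    qed
  qed
qed

section \<open>The proximal point and its optimality condition\<close>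

lemma norm_add_scaleR_sq:
  fixes a b :: "'a::real_inner"
  shows "(norm (a + t *\<^sub>R b))\<^sup>2 = (norm a)\<^sup>2 + 2 * t * (a \<bullet> b) + t\<^sup>2 * (norm b)\<^sup>2"
  unfolding power2_norm_eq_inner
  by (simp add: algebra_simps inner_commute power2_eq_square)

text \<open>This is the parallelogram law; the coefficient \<open>1 - 1/2\<close> is kept so that it
  matches \<open>ereal_convex_real\<close> at \<open>t = 1/2\<close>.\<close>

lemma norm_midpoint:
  fixes a b v :: "'a::real_inner"
  shows "(norm ((1 - 1/2) *\<^sub>R a + (1/2) *\<^sub>R b - v))\<^sup>2
    = (norm (a - v))\<^sup>2 / 2 + (norm (b - v))\<^sup>2 / 2 - (norm (a - b))\<^sup>2 / 4"
  unfolding power2_norm_eq_inner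
  by (simp add: algebra_simps inner_commute add_divide_distrib diff_divide_distrib)

text \<open>The direct method, with completeness in place of weak compactness: the quadratic term
  forces a minimizing sequence to be Cauchy, and lower semicontinuity passes the infimum to its
  limit.\<close>

lemma prox_objective_has_minimizer:
  fixes g :: "'a::{real_inner,complete_space} \<Rightarrow> ereal"
  assumes g: "ereal_convex g" "proper_fun g" "lower_semicontinuous g" and "s > 0"
  shows "\<exists>u. is_arg_min (\<lambda>u. g u + ereal (1 / (2 * s) * (norm (u - v))\<^sup>2)) (\<lambda>_. True) u"
proof -
  define h where "h = (\<lambda>u. real_of_ereal (g u))"
  define \<phi> where "\<phi> = (\<lambda>u. h u + 1 / (2 * s) * (norm (u - v))\<^sup>2)"
  define A where "A = {u. g u \<noteq> \<infinity>}"
  have ninf: "g u \<noteq> -\<infinity>" for u using g(2) by (simp add: proper_fun_def)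
  have gh: "g u = ereal (h u)" if "u \<in> A" for u
    using that ninf[of u] unfolding h_def A_def by (cases "g u") auto
  obtain a where a: "a \<in> A" using g(2) by (auto simp: proper_fun_def A_def)
  obtain c where c: "c \<ge> 0" "\<And>u. u \<in> A \<Longrightarrow> h u \<ge> h a - 1 - c * norm (u - a)"
    using ereal_convex_linear_lower_bound[OF g, of a] a unfolding A_def h_def by auto
  have bdd: "bdd_below (\<phi> ` A)"
  proof (rule bdd_belowI2)
    fix u assume u: "u \<in> A"
    have "norm (u - a) \<le> norm (u - v) + norm (v - a)"
      using norm_triangle_ineq[of "u - v" "v - a"] by simp
    then have "c * norm (u - a) \<le> c * norm (u - v) + c * norm (v - a)"
      using c(1) by (metis mult_left_mono distrib_left)
    \<comment> \<open>Young's inequality: the quadratic absorbs the linear decrease allowed to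
      \<open>g\<close>.\<close>
    moreover have "c * norm (u - v) \<le> 1 / (2 * s) * (norm (u - v))\<^sup>2 + s * c\<^sup>2 / 2"
    proof -
      have "0 \<le> (norm (u - v) - s * c)\<^sup>2 / (2 * s)" using \<open>s > 0\<close> by simp
      also have "\<dots> = 1 / (2 * s) * (norm (u - v))\<^sup>2 + s * c\<^sup>2 / 2 - c * norm (u - v)"
        using \<open>s > 0\<close> by (simp add: power2_diff field_simps power2_eq_square)
      finally show ?thesis by simp
    qed
    ultimately show "h a - 1 - c * norm (v - a) - s * c\<^sup>2 / 2 \<le> \<phi> u"
      using c(2)[OF u] unfolding \<phi>_def by linarith
  qed
  define m where "m = Inf (\<phi> ` A)"
  have m: "m \<le> \<phi> u" if "u \<in> A" for u
    unfolding m_def using bdd that by (simp add: cINF_lower)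
  have "\<exists>u\<in>A. \<phi> u < m + 1 / Suc n" for n
    using cInf_lessD[of "\<phi> ` A" "m + 1 / Suc n"] a unfolding m_def by auto
  then obtain U where U: "\<And>n. U n \<in> A" "\<And>n. \<phi> (U n) < m + 1 / Suc n"
    by metis
  \<comment> \<open>Two near-minimizers are close: their midpoint has value at least
    \<open>m\<close>, yet the parallelogram law puts it below the average of their values by
    \<open>(norm (b - d))\<^sup>2 / (8 * s)\<close>.\<close>
  have gap: "(norm (b - d))\<^sup>2 \<le> 8 * s * e" if b: "b \<in> A" "\<phi> b < m + e" and d: "d \<in> A" "\<phi> d < m + e" for b d e
  proof -
    define w where "w = (1 - 1/2) *\<^sub>R b + (1/2::real) *\<^sub>R d"
    have w: "w \<in> A" "h w \<le> h b / 2 + h d / 2"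
      using ereal_convex_real[OF g(1,2), of b d "1/2"] b d unfolding A_def h_def w_def by auto
    have "1 / (2 * s) * (norm (w - v))\<^sup>2 = 1 / (2 * s) * (norm (b - v))\<^sup>2 / 2
       + 1 / (2 * s) * (norm (d - v))\<^sup>2 / 2 - (norm (b - d))\<^sup>2 / (8 * s)"
      unfolding w_def norm_midpoint using \<open>s > 0\<close> by (simp add: field_simps)
    then have "\<phi> w \<le> \<phi> b / 2 + \<phi> d / 2 - (norm (b - d))\<^sup>2 / (8 * s)"
      using w unfolding \<phi>_def add_divide_distrib by linarith
    then have "(norm (b - d))\<^sup>2 / (8 * s) \<le> e" using m[OF w(1)] b d by linarith
    then show ?thesis using \<open>s > 0\<close> by (simp add: field_simps)
  qed
  have "Cauchy U"
  proof (rule metric_CauchyI)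
    fix e :: real assume e: "e > 0"
    obtain N where N: "1 / Suc N < e\<^sup>2 / (8 * s)"
      using nat_approx_posE[of "e\<^sup>2 / (8 * s)"] e \<open>s > 0\<close> by (metis zero_less_divide_iff zero_less_mult_iff zero_less_numeral zero_less_power)
    show "\<exists>M. \<forall>i\<ge>M. \<forall>j\<ge>M. dist (U i) (U j) < e"
    proof (intro exI allI impI)
      fix i j assume ij: "N \<le> i" "N \<le> j"
      have "\<phi> (U i) < m + 1 / Suc N" if "N \<le> i" for i
      proof -
        have "1 / real (Suc i) \<le> 1 / real (Suc N)" using that by (simp add: frac_le)
        then show ?thesis using U(2)[of i] by linarith
      qed
      then have "(norm (U i - U j))\<^sup>2 \<le> 8 * s * (1 / Suc N)"
        using gap[of "U i" "1 / Suc N" "U j"] U(1) ij by simp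
      also have "\<dots> < 8 * s * (e\<^sup>2 / (8 * s))" 
        using N \<open>s > 0\<close> by (intro mult_strict_left_mono) auto
      also have "\<dots> = e\<^sup>2" using \<open>s > 0\<close> by simp
      finally show "dist (U i) (U j) < e"
        using e by (simp add: dist_norm power_less_imp_less_base)
    qed
  qed
  then obtain z where z: "U \<longlonglongrightarrow> z"
    by (auto simp: Cauchy_convergent_iff convergent_def)
  define q where "q = 1 / (2 * s) * (norm (z - v))\<^sup>2"
  have gz: "g z \<le> ereal (m - q)"
  proof (rule ccontr)
    assume "\<not> ?thesis"
    \<comment> \<open>A level \<open>r\<close> strictly between the two values is eventually below
      \<open>g (U n)\<close>, while the values of \<open>g (U n)\<close> are bounded by a sequence
      tending to \<open>m - q\<close>.\<close>
    then obtain r where r: "ereal (m - q) < ereal r" "ereal r < g z"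
      using ereal_dense2 by (metis not_le)
    have ev: "eventually (\<lambda>n. ereal r < g (U n)) sequentially"
      using lower_semicontinuous_eventually[OF g(3) r(2)] z
      by (rule eventually_compose_filterlim)
    have "(\<lambda>n. m + 1 / Suc n - 1 / (2 * s) * (norm (U n - v))\<^sup>2) \<longlonglongrightarrow> m + 0 - q"
      unfolding q_def
      by (intro tendsto_intros z LIMSEQ_Suc[OF lim_1_over_n])
    moreover have "eventually (\<lambda>n. r \<le> m + 1 / Suc n - 1 / (2 * s) * (norm (U n - v))\<^sup>2) sequentially"
      using ev
    proof eventually_elim
      case (elim n)
      then have "r < h (U n)" using gh[OF U(1)[of n]] by simp
      then show ?case using U(2)[of n] unfolding \<phi>_def by linarith
    qed
    ultimately have "r \<le> m + 0 - q"
      by (intro tendsto_lowerbound) auto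
    then show False using r by simp
  qed
  have min: "ereal m \<le> g u + ereal (1 / (2 * s) * (norm (u - v))\<^sup>2)" for u
  proof (cases "u \<in> A")
    case True
    then show ?thesis using m[OF True] gh[OF True] by (simp add: \<phi>_def)
  qed (simp add: A_def)
  have "g z + ereal q \<le> ereal m"
    using add_right_mono[OF gz, of "ereal q"] by simp
  then show ?thesis
    unfolding is_arg_min_linorder q_def using min order_trans by blast
qed

text \<open>Minimality says that \<open>(v - z) / s\<close> is a subgradient of \<open>g\<close> at
  \<open>z\<close>. It is extracted by comparing \<open>z\<close> with a point at fraction
  \<open>t\<close> of the way to \<open>u\<close>, dividing by \<open>t\<close> and letting
  \<open>t\<close> tend to 0 from the right. Finiteness of \<open>g z\<close> comes from comparison
  with any point of the domain.\<close>

lemma prox_subgradient: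
  fixes g :: "'a::{real_inner,complete_space} \<Rightarrow> ereal"
  assumes g: "ereal_convex g" "proper_fun g" "lower_semicontinuous g" and "s > 0"
    and z: "z = prox s g v"
  shows "g z \<noteq> \<infinity>"
    and "g u \<noteq> \<infinity> \<Longrightarrow> real_of_ereal (g z) \<le> real_of_ereal (g u) + (1 / s) * ((z - v) \<bullet> (u - z))"
proof -
  have ninf: "g u \<noteq> -\<infinity>" for u using g(2) by (simp add: proper_fun_def)
  have "is_arg_min (\<lambda>u. g u + ereal (1 / (2 * s) * (norm (u - v))\<^sup>2)) (\<lambda>_. True) z"
    using prox_objective_has_minimizer[OF g \<open>s > 0\<close>, of v] 
    unfolding z prox_def arg_min_def by (rule someI_ex)
  then have min: "g z + ereal (1 / (2 * s) * (norm (z - v))\<^sup>2)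
    \<le> g u + ereal (1 / (2 * s) * (norm (u - v))\<^sup>2)" for u
    by (simp add: is_arg_min_linorder)
  show fin: "g z \<noteq> \<infinity>"
  proof -
    obtain b where "g b \<noteq> \<infinity>" using g(2) by (auto simp: proper_fun_def)
    then show ?thesis using min[of b] by auto
  qed
  assume u: "g u \<noteq> \<infinity>"
  define h where "h = (\<lambda>u. real_of_ereal (g u))"
  define q where "q = (z - v) \<bullet> (u - z)"
  define n where "n = (norm (u - z))\<^sup>2"
  have key: "h z - h u - 1 / s * q \<le> t * (n / (2 * s))" if t: "0 < t" "t < 1" for t
  proof -
    define w where "w = (1 - t) *\<^sub>R z + t *\<^sub>R u"
    have w: "g w \<noteq> \<infinity>" "h w \<le> (1 - t) * h z + t * h u"
      unfolding w_def h_def using ereal_convex_real[OF g(1,2) fin u, of t] t by auto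
    have "h z + 1 / (2 * s) * (norm (z - v))\<^sup>2 \<le> h w + 1 / (2 * s) * (norm (w - v))\<^sup>2"
      using min[of w] fin w(1) ninf[of z] ninf[of w] unfolding h_def
      by (cases "g z"; cases "g w") auto
    moreover have "(norm (w - v))\<^sup>2 = (norm (z - v))\<^sup>2 + 2 * t * q + t\<^sup>2 * n"
    proof -
      have "w - v = (z - v) + t *\<^sub>R (u - z)" by (simp add: w_def algebra_simps)
      then show ?thesis by (simp only: q_def n_def norm_add_scaleR_sq)
    qed
    ultimately have "h z \<le> h w + 1 / (2 * s) * (2 * t * q + t\<^sup>2 * n)"
      by (simp add: distrib_left add.assoc)
    then have "t * (h z - h u) \<le> 1 / (2 * s) * (2 * t * q + t\<^sup>2 * n)"
      using w(2) by (simp only: left_diff_distrib right_diff_distrib mult_1)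
    also have "\<dots> = t * (1 / s * q + t * (n / (2 * s)))"
      using \<open>s > 0\<close> by (simp add: field_simps power2_eq_square)
    finally have "t * (h z - h u) \<le> t * (1 / s * q + t * (n / (2 * s)))" .
    then show ?thesis using t by simp
  qed
  have "((\<lambda>t. t * (n / (2 * s))) \<longlongrightarrow> 0 * (n / (2 * s))) (at_right 0)"
    by (intro tendsto_intros)
  moreover have "eventually (\<lambda>t. h z - h u - 1 / s * q \<le> t * (n / (2 * s))) (at_right (0::real))"
    using key unfolding eventually_at_right_field by (intro exI[of _ 1]) auto
  ultimately have "h z - h u - 1 / s * q \<le> 0 * (n / (2 * s))"
    by (rule tendsto_lowerbound) simp
  then show "real_of_ereal (g z) \<le> real_of_ereal (g u) + (1 / s) * ((z - v) \<bullet> (u - z))"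
    unfolding h_def q_def by simp
qed

text \<open>The sum of the tangent bound for \<open>f u\<close>, the descent bound for
  \<open>f z\<close> and the subgradient bound for \<open>g\<close>. With
  \<open>z = x - s *\<^sub>R G\<close> the gradient terms cancel, and the squares of
  \<open>G\<close> contribute \<open>- s + s\<^sup>2 * L / 2\<close>.\<close>

lemma prox_gradient_inequality:
  fixes f :: "'a::{real_inner,complete_space} \<Rightarrow> real" and g :: "'a \<Rightarrow> ereal"
  assumes f: "strongly_convex \<mu> f" "L_smooth L f"
    and g: "ereal_convex g" "proper_fun g" "lower_semicontinuous g" and "s > 0"
    and z: "z = prox s g (x - s *\<^sub>R grad f x)" and G: "G = (1 / s) *\<^sub>R (x - z)"
    and u: "g u \<noteq> \<infinity>"
  shows "(f z + real_of_ereal (g z)) - (f u + real_of_ereal (g u))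
    \<le> G \<bullet> (x - u) - s / 2 * (2 - s * L) * (norm G)\<^sup>2 - \<mu> / 2 * (norm (x - u))\<^sup>2"
proof -
  let ?D = "grad f x"
  have zx: "z = x - s *\<^sub>R G" using G \<open>s > 0\<close> by simp
  have 1: "f u \<ge> f x + ?D \<bullet> (u - x) + \<mu> / 2 * (norm (u - x))\<^sup>2"
    using strongly_convex_tangent[OF f(1) L_smooth_GDERIV[OF f(2)]] .
  have 2: "f z \<le> f x + ?D \<bullet> (z - x) + L / 2 * (norm (z - x))\<^sup>2"
    using f(2) by (intro lipschitz_gradient_descent L_smooth_GDERIV) (auto simp: L_smooth_def)
  have 3: "real_of_ereal (g z) \<le> real_of_ereal (g u) + (1 / s) * ((z - (x - s *\<^sub>R ?D)) \<bullet> (u - z))"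
    using prox_subgradient(2)[OF g \<open>s > 0\<close> z u] .
  have "(1 / s) * ((z - (x - s *\<^sub>R ?D)) \<bullet> (u - z)) = ((1 / s) *\<^sub>R (s *\<^sub>R (?D - G))) \<bullet> (u - z)"
    unfolding zx by (simp add: algebra_simps)
  also have "\<dots> = (?D - G) \<bullet> (u - z)" using \<open>s > 0\<close> by simp
  also have "\<dots> = ?D \<bullet> (u - x) - ?D \<bullet> (z - x) + G \<bullet> (x - u) - s * (norm G)\<^sup>2"
    unfolding zx power2_norm_eq_inner by (simp add: algebra_simps)
  finally have 4: "(1 / s) * ((z - (x - s *\<^sub>R ?D)) \<bullet> (u - z))
    = ?D \<bullet> (u - x) - ?D \<bullet> (z - x) + G \<bullet> (x - u) - s * (norm G)\<^sup>2" .
  have 5: "(norm (z - x))\<^sup>2 = s\<^sup>2 * (norm G)\<^sup>2" unfolding zx by (simp add: power_mult_distrib)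
  show ?thesis using 1 2 3 unfolding 4 5 norm_minus_commute[of u x]
    by (simp add: algebra_simps power2_eq_square)
qed

section \<open>One-step contraction of the Lyapunov function\<close>

text \<open>One iteration in isolation: \<open>c\<close> is the minimizer, \<open>Fy\<close> and
  \<open>Fn\<close> are the old and new values, \<open>W\<close> and \<open>V\<close> the old and
  new auxiliary points. The decrease and an upper bound for the new energy are written in the same
  two quantities, \<open>M\<close> and \<open>t\<^sup>2 * n\<close>; comparing coefficients gives
  the two conditions on \<rho>. The alternative \<open>t = 1\<close> in \<open>H1\<close> covers an
  initial point outside the domain.\<close>

lemma lyapunov_step:
  fixes G X Y c :: "'a::real_inner" and s L \<mu> \<gamma> \<rho> t :: real
  assumes pos: "0 < \<mu>" "0 < s" "0 < \<gamma>" "0 \<le> \<rho>" and t: "1 \<le> t"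
    and rho: "\<rho> \<le> \<mu> * \<gamma> * s / 2"
      "\<rho> * (1 - \<mu> * s * (2 - 2 * \<gamma> - s * L)) \<le> \<mu> * s * (2 - \<gamma> - s * L)"
    and H1: "t = 1 \<or>
      Fz - Fy \<le> G \<bullet> (X - Y) - s / 2 * (2 - s * L) * (norm G)\<^sup>2 - \<mu> / 2 * (norm (X - Y))\<^sup>2"
    and H2: "Fz - Fc \<le> G \<bullet> (X - c) - s / 2 * (2 - s * L) * (norm G)\<^sup>2 - \<mu> / 2 * (norm (X - c))\<^sup>2"
    and Fn: "Fn \<le> Fz"
    and W: "W = t *\<^sub>R X - (t - 1) *\<^sub>R Y" and V: "V = W - (\<gamma> * s * t) *\<^sub>R G"
  shows "(1 + \<rho>) * (t\<^sup>2 * (Fn - Fc) + (norm (V - c))\<^sup>2 / (2 * \<gamma> * s))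
    \<le> t * (t - 1) * (Fy - Fc) + (norm (W - c))\<^sup>2 / (2 * \<gamma> * s)"
proof -
  define n A B w v where defs: "n = (norm G)\<^sup>2" "A = (norm (X - Y))\<^sup>2" "B = (norm (X - c))\<^sup>2"
    "w = (norm (W - c))\<^sup>2" "v = (norm (V - c))\<^sup>2"
  define p q where pq: "p = G \<bullet> (X - Y)" "q = G \<bullet> (X - c)"
  define M where "M = t * (t - 1) * A + t * B"
  have n0: "n \<ge> 0" and M0: "M \<ge> 0" using t by (auto simp: defs M_def)
  have Wc: "W - c = (X - c) + (t - 1) *\<^sub>R (X - Y)" unfolding W by (simp add: algebra_simps)
  have Vc: "V - c = (W - c) + (- (\<gamma> * s * t)) *\<^sub>R G" unfolding V by simp
  have v: "v = w - 2 * \<gamma> * s * t * ((t - 1) * p + q) + \<gamma>\<^sup>2 * s\<^sup>2 * t\<^sup>2 * n"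
  proof -
    have "v = w - 2 * \<gamma> * s * t * (G \<bullet> (W - c)) + \<gamma>\<^sup>2 * s\<^sup>2 * t\<^sup>2 * n"
      unfolding defs Vc norm_add_scaleR_sq by (simp add: inner_commute power_mult_distrib)
    then show ?thesis unfolding Wc pq by (simp add: inner_add_right)
  qed
  \<comment> \<open>Bounding the doubled inner product by \<open>A + B\<close> turns the
    coefficients \<open>(t - 1)\<^sup>2\<close> and 1 into \<open>t * (t - 1)\<close> and
    \<open>t\<close>.\<close>
  have wM: "w \<le> M"
  proof -
    have "2 * ((X - Y) \<bullet> (X - c)) \<le> A + B"
    proof -
      have "0 \<le> (norm ((X - Y) + (-1) *\<^sub>R (X - c)))\<^sup>2" by simp
      also have "\<dots> = A + B - 2 * ((X - Y) \<bullet> (X - c))"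
        unfolding defs norm_add_scaleR_sq by simp
      finally show ?thesis by simp
    qed
    then have "(t - 1) * (2 * ((X - Y) \<bullet> (X - c))) \<le> (t - 1) * (A + B)"
      using t by (intro mult_left_mono) auto
    moreover have "w = (t - 1)\<^sup>2 * A + B + (t - 1) * (2 * ((X - Y) \<bullet> (X - c)))"
      unfolding defs Wc norm_add_scaleR_sq by (simp add: inner_commute)
    ultimately show ?thesis unfolding M_def by (simp add: power2_eq_square algebra_simps)
  qed
  \<comment> \<open>The squared norm of a difference is at most twice the sum of the squared
    norms.\<close>
  have vM: "v \<le> 2 * M + 2 * \<gamma>\<^sup>2 * s\<^sup>2 * t\<^sup>2 * n"
  proof -
    have "0 \<le> (norm ((W - c) + (\<gamma> * s * t) *\<^sub>R G))\<^sup>2" by simp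
    also have "\<dots> = 2 * w + 2 * \<gamma>\<^sup>2 * s\<^sup>2 * t\<^sup>2 * n - v"
      unfolding defs Vc norm_add_scaleR_sq by (simp add: power_mult_distrib)
    finally show ?thesis using wM by simp
  qed
  define R where "R = n / (2 * \<mu>) - s / 2 * (2 - s * L) * n"
  \<comment> \<open>The two quadratic terms of H2 are completed to a square, so strong convexity bounds the gap by the squared norm of G alone.\<close>
  have FR: "Fn - Fc \<le> R"
  proof -
    have "0 \<le> (norm (G - \<mu> *\<^sub>R (X - c)))\<^sup>2 / (2 * \<mu>)" using pos by simp
    also have "(norm (G - \<mu> *\<^sub>R (X - c)))\<^sup>2 = n - 2 * \<mu> * q + \<mu>\<^sup>2 * B"
      using norm_add_scaleR_sq[of G "- \<mu>" "X - c"] unfolding defs pq by simp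
    also have "\<dots> / (2 * \<mu>) = n / (2 * \<mu>) - q + \<mu> / 2 * B"
      using pos by (simp add: field_simps power2_eq_square)
    finally show ?thesis using H2 Fn unfolding R_def defs pq by linarith
  qed
  define K where "K = s / 2 * (2 - s * L) * n"
  \<comment> \<open>The weights \<open>t * (t - 1)\<close> and \<open>t\<close> sum to
    \<open>t\<^sup>2\<close> and combine the inner products into \<open>G \<bullet> (W - c)\<close>,
    up to the factor \<open>t\<close>. For \<open>t = 1\<close> both sides here vanish.\<close>
  have "t * (t - 1) * (Fz - Fy) \<le> t * (t - 1) * (p - K - \<mu> / 2 * A)"
    using H1 t unfolding K_def defs pq by (auto intro: mult_left_mono)
  moreover have "t * (Fz - Fc) \<le> t * (q - K - \<mu> / 2 * B)"
    using H2 t unfolding K_def defs pq by (intro mult_left_mono) auto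
  moreover have "t\<^sup>2 * (Fn - Fz) \<le> 0" using Fn by (simp add: mult_nonneg_nonpos)
  ultimately have main: "t\<^sup>2 * (Fn - Fc) \<le> t * (t - 1) * (Fy - Fc)
      + t * ((t - 1) * p + q) - t\<^sup>2 * K - \<mu> / 2 * M"
    unfolding M_def
    by (simp add: algebra_simps power2_eq_square add_divide_distrib diff_divide_distrib)
  have gs: "2 * \<gamma> * s > 0" using pos by simp
  \<comment> \<open>The inner-product term cancels the one in \<open>main\<close>; the remaining
    square of \<open>G\<close> lowers the factor \<open>2 - s * L\<close> in \<open>K\<close> to
    \<open>2 - \<gamma> - s * L\<close>.\<close>
  have "v / (2 * \<gamma> * s) = w / (2 * \<gamma> * s) - t * ((t - 1) * p + q) + \<gamma> * s / 2 * t\<^sup>2 * n"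
    unfolding v using pos by (simp add: divide_simps) (simp add: algebra_simps power2_eq_square)
  moreover have "t\<^sup>2 * K = t\<^sup>2 * (s / 2 * (2 - \<gamma> - s * L) * n) + \<gamma> * s / 2 * t\<^sup>2 * n"
    unfolding K_def by (simp add: field_simps)
  ultimately have decr: "t\<^sup>2 * (Fn - Fc) + v / (2 * \<gamma> * s) \<le> t * (t - 1) * (Fy - Fc) + w / (2 * \<gamma> * s)
      - t\<^sup>2 * (s / 2 * (2 - \<gamma> - s * L) * n) - \<mu> / 2 * M"
    using main by linarith
  \<comment> \<open>Now the new energy is bounded from above, so that \<rho> times it fits inside
    the decrease just found.\<close>
  have "t\<^sup>2 * (Fn - Fc) + v / (2 * \<gamma> * s) \<le> t\<^sup>2 * R + (2 * M + 2 * \<gamma>\<^sup>2 * s\<^sup>2 * t\<^sup>2 * n) / (2 * \<gamma> * s)"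
    using FR vM gs by (intro add_mono mult_left_mono divide_right_mono) auto
  also have "\<dots> = M / (\<gamma> * s) + t\<^sup>2 * (R + \<gamma> * s * n)"
    using pos by (simp add: divide_simps) (simp add: algebra_simps power2_eq_square)
  also have "R + \<gamma> * s * n = (1 - \<mu> * s * (2 - 2 * \<gamma> - s * L)) * (n / (2 * \<mu>))"
    unfolding R_def using pos by (simp add: divide_simps) (simp add: algebra_simps power2_eq_square)
  finally have "\<rho> * (t\<^sup>2 * (Fn - Fc) + v / (2 * \<gamma> * s))
     \<le> \<rho> * (M / (\<gamma> * s) + t\<^sup>2 * ((1 - \<mu> * s * (2 - 2 * \<gamma> - s * L)) * (n / (2 * \<mu>))))"
    using pos by (intro mult_left_mono) auto
  also have "\<dots> = \<rho> * (M / (\<gamma> * s)) + \<rho> * (1 - \<mu> * s * (2 - 2 * \<gamma> - s * L)) * (t\<^sup>2 * (n / (2 * \<mu>)))"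
    by (simp add: algebra_simps)
  also have "\<dots> \<le> \<mu> * \<gamma> * s / 2 * (M / (\<gamma> * s)) + \<mu> * s * (2 - \<gamma> - s * L) * (t\<^sup>2 * (n / (2 * \<mu>)))"
    using rho pos n0 M0 by (intro add_mono mult_right_mono) auto
  also have "\<dots> = \<mu> / 2 * M + t\<^sup>2 * (s / 2 * (2 - \<gamma> - s * L) * n)"
    using pos by (simp add: field_simps)
  finally show ?thesis using decr unfolding defs by (simp add: distrib_right)
qed

section \<open>The step sequence and the convergence rate\<close>

lemma tseq_ge_1: "1 \<le> tseq k"
  by (cases k) (auto intro: order_trans[of _ 1])

text \<open>The recursion picks the positive root of
  \<open>T\<^sup>2 - T = (tseq k)\<^sup>2\<close>. Hence the factor \<open>t\<^sup>2\<close> in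
  \<open>lyapunov_step\<close> is the coefficient of the next energy.\<close>

lemma tseq_Suc_mult: "tseq (Suc k) * (tseq (Suc k) - 1) = (tseq k)\<^sup>2"
proof -
  have "(sqrt (1 + 4 * (tseq k)\<^sup>2))\<^sup>2 = 1 + 4 * (tseq k)\<^sup>2" by simp
  then show ?thesis by (simp add: field_simps power2_eq_square)
qed

theorem theorem7:
  fixes f :: "'a::{real_inner,complete_space} \<Rightarrow> real"
    and g :: "'a \<Rightarrow> ereal"
    and L \<mu> s \<gamma> \<rho> :: real
    and x y z :: "nat \<Rightarrow> 'a"
    and xstar :: 'a
    and F :: "'a \<Rightarrow> ereal"
  assumes "0 < \<mu>" and "\<mu> \<le> L"
    and "strongly_convex \<mu> f" and "L_smooth L f"
    and "ereal_convex g" and "proper_fun g" and "lower_semicontinuous g"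
    and F_def: "F = composite f g"
    and "is_arg_min F (\<lambda>_. True) xstar"
    and "0 < s" and "s \<le> 1 / L"
    and "(1 - s * L) / 4 < \<gamma>" and "\<gamma> < 2 - s * L"
    and "M_APM f g s \<gamma> x y z"
    and rho_def: "\<rho> = min (\<mu> * s * (2 - \<gamma> - s * L) / (1 - \<mu> * s * (2 - 4 * \<gamma> - s * L)))
                          (\<mu> * \<gamma> * s / 2)"
  shows "\<forall>k\<ge>2. F (y k) - F xstar
    \<le> ereal ((norm (x 0 - xstar))\<^sup>2 / (2 * \<gamma> * s * tseq k * (tseq k - 1))
        * (1 + \<rho>) powi (2 - int k))"
proof -
  have ninf: "g u \<noteq> -\<infinity>" for u using assms(6) by (simp add: proper_fun_def)
  have sL: "s * L \<le> 1" using assms(1,2,11) by (simp add: field_simps)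
  have "\<mu> * s \<le> L * s" using assms(2,10) by (intro mult_right_mono) auto
  then have a: "0 < \<mu> * s" "\<mu> * s \<le> 1"
    using assms(1,10) sL mult.commute[of L s] by (simp, linarith)
  have \<gamma>: "0 < \<gamma>" using sL assms(12) by simp
  \<comment> \<open>The lower bound on \<gamma> means \<open>2 - 4 * \<gamma> - s * L < 1\<close>,
    which with \<open>\<mu> * s \<le> 1\<close> makes the denominator in \<rho> positive.\<close>
  have "\<mu> * s * (2 - 4 * \<gamma> - s * L) < \<mu> * s * 1"
    using a assms(12) by (intro mult_strict_left_mono) auto
  then have den: "0 < 1 - \<mu> * s * (2 - 4 * \<gamma> - s * L)" using a by linarith
  have rho0: "0 < \<rho>" 
    unfolding rho_def min_less_iff_conj using assms(1,10,13) a \<gamma> den by auto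
  have rho1: "\<rho> \<le> \<mu> * \<gamma> * s / 2" unfolding rho_def by (rule min.cobounded2)
  have "\<rho> \<le> \<mu> * s * (2 - \<gamma> - s * L) / (1 - \<mu> * s * (2 - 4 * \<gamma> - s * L))"
    unfolding rho_def by (rule min.cobounded1)
  then have "\<rho> * (1 - \<mu> * s * (2 - 4 * \<gamma> - s * L)) \<le> \<mu> * s * (2 - \<gamma> - s * L)"
    using den by (simp add: pos_le_divide_eq)
  \<comment> \<open>\<open>lyapunov_step\<close> has \<open>2 * \<gamma>\<close> where \<rho> is
    defined with \<open>4 * \<gamma>\<close>; the change only lowers the factor, as
    \<open>\<mu> * s * \<gamma>\<close> is positive.\<close>
  moreover have "\<rho> * (1 - \<mu> * s * (2 - 2 * \<gamma> - s * L)) \<le> \<rho> * (1 - \<mu> * s * (2 - 4 * \<gamma> - s * L))"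
    using rho0 a \<gamma> by (intro mult_left_mono diff_left_mono) auto
  ultimately have rho2: "\<rho> * (1 - \<mu> * s * (2 - 2 * \<gamma> - s * L)) \<le> \<mu> * s * (2 - \<gamma> - s * L)"
    by linarith
  define Fr where "Fr = (\<lambda>u. f u + real_of_ereal (g u))"
  have F_real: "F u = ereal (Fr u)" if "g u \<noteq> \<infinity>" for u
    using that ninf[of u] unfolding F_def composite_def Fr_def by (cases "g u") auto
  have F_inf: "F u = \<infinity>" if "g u = \<infinity>" for u
    using that by (simp add: F_def composite_def)
  have alg: "z k = prox s g (x k - s *\<^sub>R grad f (x k))"
    "y (Suc k) = (if F (z k) \<le> F (y k) then z k else y k)"
    "x (Suc k) = y (Suc k)
       + ((tseq k - 1) / tseq (Suc k)) *\<^sub>R (y (Suc k) - y k)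
       + (tseq k / tseq (Suc k)) *\<^sub>R (z k - y (Suc k))
       + (tseq k * (\<gamma> - 1) / tseq (Suc k)) *\<^sub>R (z k - x k)" for k
    using assms(14) unfolding M_APM_def F_def by blast+
  have z: "g (z k) \<noteq> \<infinity>" for k
    using prox_subgradient(1)[OF assms(5-7,10) alg(1)] .
  \<comment> \<open>The old point is kept only when its value is below the finite
    \<open>F (z k)\<close>, so every \<open>y\<close> after the initial one lies in the
    domain.\<close>
  have y: "g (y (Suc k)) \<noteq> \<infinity>" for k
    using z[of k] F_inf[of "y k"] F_real[OF z[of k]] unfolding alg(2)[of k] by auto
  obtain b where "g b \<noteq> \<infinity>" using assms(6) by (auto simp: proper_fun_def)
  moreover have "F xstar \<le> F b" using assms(9) by (simp add: is_arg_min_linorder)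
  ultimately have xs: "g xstar \<noteq> \<infinity>" using F_real[of b] F_inf[of xstar] by auto
  have F_min: "Fr xstar \<le> Fr u" if "g u \<noteq> \<infinity>" for u
  proof -
    have "F xstar \<le> F u" using assms(9) by (simp add: is_arg_min_linorder)
    then show ?thesis using F_real[OF that] F_real[OF xs] by simp
  qed
  have Fy: "Fr (y (Suc k)) \<le> Fr (z k)" for k
  proof -
    have "F (y (Suc k)) \<le> F (z k)" unfolding alg(2)[of k] by auto
    then show ?thesis using F_real[OF z[of k]] F_real[OF y[of k]] by simp
  qed
  define G where "G = (\<lambda>k. (1 / s) *\<^sub>R (x k - z k))"
  define W where "W = (\<lambda>k. tseq k *\<^sub>R x k - (tseq k - 1) *\<^sub>R y k)"
  have W_Suc: "W (Suc k) = W k - (\<gamma> * s * tseq k) *\<^sub>R G k" for k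
  proof -
    define T where "T = tseq (Suc k)"
    have T: "T > 0" using tseq_ge_1[of "Suc k"] unfolding T_def by linarith
    \<comment> \<open>Clearing the denominator leaves \<open>y (Suc k)\<close> with total
      coefficient \<open>T - 1\<close>, exactly what \<open>W (Suc k)\<close> subtracts.\<close>
    have "T *\<^sub>R x (Suc k) = T *\<^sub>R y (Suc k) + (tseq k - 1) *\<^sub>R (y (Suc k) - y k)
       + tseq k *\<^sub>R (z k - y (Suc k)) + (tseq k * (\<gamma> - 1)) *\<^sub>R (z k - x k)"
      unfolding alg(3)[of k] T_def[symmetric] using T by (simp add: scaleR_add_right)
    then have "W (Suc k) = W k - (\<gamma> * tseq k) *\<^sub>R (x k - z k)"
      unfolding W_def T_def[symmetric] by (simp add: algebra_simps)
    then show ?thesis using assms(10) by (simp add: G_def)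
  qed
  \<comment> \<open>If \<open>g (y 0)\<close> is infinite, \<open>real_of_ereal\<close> makes
    \<open>Fr (y 0)\<close> a meaningless real, but its coefficient at index 0 is zero.\<close>
  define E where "E = (\<lambda>k. tseq k * (tseq k - 1) * (Fr (y k) - Fr xstar) + (norm (W k - xstar))\<^sup>2 / (2 * \<gamma> * s))"
  have step: "(1 + \<rho>) * E (Suc k) \<le> E k" for k
    unfolding E_def tseq_Suc_mult
  proof (rule lyapunov_step[where G = "G k" and X = "x k" and Y = "y k" and L = L and Fz = "Fr (z k)" and \<mu> = \<mu>])
    have ineq: "Fr (z k) - Fr u \<le> G k \<bullet> (x k - u) - s / 2 * (2 - s * L) * (norm (G k))\<^sup>2
      - \<mu> / 2 * (norm (x k - u))\<^sup>2" if "g u \<noteq> \<infinity>" for u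
      using prox_gradient_inequality[OF assms(3-7,10) alg(1)[of k] G_def[THEN fun_cong] that]
      unfolding Fr_def .
    show "Fr (z k) - Fr xstar \<le> G k \<bullet> (x k - xstar) - s / 2 * (2 - s * L) * (norm (G k))\<^sup>2
      - \<mu> / 2 * (norm (x k - xstar))\<^sup>2"
      using ineq[OF xs] .
    \<comment> \<open>Index 0 uses the first alternative; at later indices \<open>y k\<close> is in
      the domain and the inequality applies.\<close>
    show "tseq k = 1 \<or> Fr (z k) - Fr (y k) \<le> G k \<bullet> (x k - y k)
      - s / 2 * (2 - s * L) * (norm (G k))\<^sup>2 - \<mu> / 2 * (norm (x k - y k))\<^sup>2"
    proof (cases k)
      case (Suc j)
      then show ?thesis using ineq[of "y k"] y[of j] by simp
    qed simp
  qed (use assms(1,10) \<gamma> rho0 rho1 rho2 tseq_ge_1 Fy W_Suc in \<open>auto simp: W_def\<close>)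
  have E_bound: "(1 + \<rho>) ^ k * E k \<le> E 0" for k
  proof (induction k)
    case (Suc k)
    have "(1 + \<rho>) ^ k * ((1 + \<rho>) * E (Suc k)) \<le> (1 + \<rho>) ^ k * E k"
      using step rho0 by (intro mult_left_mono) auto
    with Suc show ?case by (simp add: algebra_simps)
  qed simp
  show ?thesis
  proof (intro allI impI)
    fix k :: nat assume k: "k \<ge> 2"
    then obtain j where j: "k = Suc j" by (cases k) auto
    have gy: "g (y k) \<noteq> \<infinity>" using y j by simp
    define d where "d = Fr (y k) - Fr xstar"
    define N where "N = (norm (x 0 - xstar))\<^sup>2 / (2 * \<gamma> * s)"
    define T where "T = tseq k * (tseq k - 1)"
    have T: "T > 0" using tseq_ge_1[of j] unfolding T_def j tseq_Suc_mult by simp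
    have N: "N \<ge> 0" using \<gamma> assms(10) by (simp add: N_def)
    have d: "d \<ge> 0" using F_min[OF gy] by (simp add: d_def)
    have E0: "E 0 = N" by (simp add: E_def W_def N_def)
    have "T * d \<le> E k" using \<gamma> assms(10) by (simp add: E_def T_def d_def)
    then have "(1 + \<rho>) ^ k * (T * d) \<le> N"
      using E_bound[of k] rho0 unfolding E0
      by (meson mult_left_mono order_trans zero_le_power add_nonneg_nonneg zero_le_one less_imp_le)
    \<comment> \<open>The energy estimate gives the power \<open>k\<close>; it is weakened to the
      exponent \<open>k - 2\<close> of the claim, a true subtraction since
      \<open>k \<ge> 2\<close>.\<close>
    moreover have "(1 + \<rho>) ^ (k - 2) * (T * d) \<le> (1 + \<rho>) ^ k * (T * d)"
      using rho0 T d by (intro mult_right_mono power_increasing) auto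
    ultimately have "(1 + \<rho>) ^ (k - 2) * (T * d) \<le> N" by linarith
    then have "d \<le> N / T / (1 + \<rho>) ^ (k - 2)"
      using T rho0 by (simp add: field_simps)
    also have "\<dots> = N / T * (1 + \<rho>) powi (2 - int k)"
    proof -
      have "2 - int k = - int (k - 2)" using k by simp
      then show ?thesis by (simp only: power_int_minus power_int_of_nat divide_inverse)
    qed
    also have "N / T = (norm (x 0 - xstar))\<^sup>2 / (2 * \<gamma> * s * tseq k * (tseq k - 1))"
      by (simp add: N_def T_def mult.assoc)
    finally show "F (y k) - F xstar
      \<le> ereal ((norm (x 0 - xstar))\<^sup>2 / (2 * \<gamma> * s * tseq k * (tseq k - 1))
        * (1 + \<rho>) powi (2 - int k))"
      using F_real[OF gy] F_real[OF xs] by (simp add: d_def)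
  qed
qed

end
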